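(* Let $n\ge 3$. Let $U_n:=\{M\in\mathcal S^{n\times n}\mid \lambda(M)\in\Gamma_n\}$ and $F_n(M):=\sigma_n(\lambda(M))^{1/n}$ for $M\in U_n$. If $u\in C^2(B_2\setminus\{0\})$ satisfies $$u>0,\quad A^u\in U_n,\quad F_n(A^u)=1\qquad\text{in } B_2\setminus\{0\},$$ then $u$ can be extended as a positive Lipschitz function in $B_1$.
   Context: $\mathcal S^{n\times n}$ is the set of real symmetric $n\times n$ matrices; $\lambda(M)=(\lambda_1,\dots,\lambda_n)$ denotes the eigenvalues of $M$; $\sigma_n(\lambda)=\lambda_1\cdots\lambda_n$; $\Gamma_n=\{\lambda\in\mathbb R^n\mid \lambda_i>0 \text{ for all } i\}$. $B_a\subset\mathbb R^n$ is the ball of radius $a$ centered at the origin. For a positive $C^2$ function $u$, $$A^u=-\frac{2}{n-2}u^{-\frac{n+2}{n-2}}\nabla^2u+\frac{2n}{(n-2)^2}u^{-\frac{2n}{n-2}}\nabla u\otimes\nabla u-\frac{2}{(n-2)^2}u^{-\frac{2n}{n-2}}|\nabla u|^2 I,$$ where $\nabla u$ is the gradient, $\nabla^2u$ the Hessian of $u$ and $I$ the identity matrix. *)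

theory Defs
  imports "HOL-Analysis.Analysis"
begin

definition gradient :: "('a::real_inner \<Rightarrow> real) \<Rightarrow> 'a \<Rightarrow> 'a" where
  "gradient u x = (THE D. GDERIV u x :> D)"

definition hessian :: "(real^'n \<Rightarrow> real) \<Rightarrow> real^'n \<Rightarrow> real^'n^'n" where
  "hessian u x = jacobian (gradient u) (at x)"

(* Intended for open S, where the derivatives at points of S depend only on the values of u on S. *)
definition C2_on :: "(real^'n) set \<Rightarrow> (real^'n \<Rightarrow> real) \<Rightarrow> bool" where
  "C2_on S u \<longleftrightarrow>
     (\<forall>x\<in>S. u differentiable (at x)) \<and>
     (\<forall>x\<in>S. gradient u differentiable (at x)) \<and>
     continuous_on S (hessian u)"

definition outer_product :: "real^'n \<Rightarrow> real^'n \<Rightarrow> real^'n^'n" where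
  "outer_product v w = (\<chi> i j. v $ i * w $ j)"

(* The matrix A^u at the point x; u x is positive wherever this is used. *)
definition conformal_hessian :: "(real^'n \<Rightarrow> real) \<Rightarrow> real^'n \<Rightarrow> real^'n^'n" where
  "conformal_hessian u x =
     (let n = real CARD('n) in
        (- (2 / (n - 2)) * u x powr (- ((n + 2) / (n - 2)))) *\<^sub>R hessian u x
      + (2 * n / (n - 2)\<^sup>2 * u x powr (- (2 * n / (n - 2))))
          *\<^sub>R outer_product (gradient u x) (gradient u x)
      - (2 / (n - 2)\<^sup>2 * u x powr (- (2 * n / (n - 2))) * (norm (gradient u x))\<^sup>2)
          *\<^sub>R mat 1)"

(* The n-tuple of roots of the characteristic polynomial, counted with multiplicity. It exists
   for symmetric M and is unique up to reordering; the ordering chosen is irrelevant below,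
   since Gamma_n and sigma_n are invariant under permutations of the coordinates. *)
definition eigenvalues :: "real^'n^'n \<Rightarrow> real^'n" where
  "eigenvalues M =
     (SOME l. \<forall>t::real. det (t *\<^sub>R mat 1 - M) = (\<Prod>i\<in>UNIV. t - l $ i))"

definition sigma_n :: "real^'n \<Rightarrow> real" where
  "sigma_n l = (\<Prod>i\<in>UNIV. l $ i)"

definition Gamma_n :: "(real^'n) set" where
  "Gamma_n = {l. \<forall>i. l $ i > 0}"

definition U_n :: "(real^'n^'n) set" where
  "U_n = {M. transpose M = M \<and> eigenvalues M \<in> Gamma_n}"

definition F_n :: "real^'n^'n \<Rightarrow> real" where
  "F_n M = root CARD('n) (sigma_n (eigenvalues M))"

end

theory Submission
  imports Defs
begin

text \<open>
  Put \<open>n = CARD('n)\<close>, \<open>p = -2/(n-2)\<close> and \<open>w = u\<^sup>p\<close>, so that the metric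
  \<open>u\<^bsup>4/(n-2)\<^esup> |dx|\<^sup>2\<close> is \<open>w\<^bsup>-2\<^esup> |dx|\<^sup>2\<close>. In terms of \<open>w\<close> the matrix \<open>A\<^sup>u\<close> is
  \<open>w \<nabla>\<^sup>2w - \<bar>\<nabla>w\<bar>\<^sup>2/2 I\<close>, and it is positive definite because it is symmetric with positive
  eigenvalues. Positivity enters in three ways.

  First, \<open>w\<close> has positive definite Hessian. In dimension at least two a segment through the
  puncture is a limit of segments that avoid it, so \<open>w\<close> lies above all its tangent planes on the
  punctured ball (\<open>tangent_below\<close>). Comparing with the values of \<open>w\<close> on the sphere of radius 3/2 bounds
  \<open>\<nabla>w\<close>, hence \<open>w\<close> is Lipschitz near the puncture and has a limit \<open>W 0 \<ge> 0\<close> there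
  (\<open>lipschitz_near_puncture\<close>).

  Secondly, \<open>w w'' \<ge> (w')\<^sup>2/2\<close> along lines, which says that \<open>sqrt w\<close> is convex along them. If
  \<open>W 0 = 0\<close>, convexity on the rays from the origin gives \<open>w x \<le> C \<bar>x\<bar>\<^sup>2\<close> (\<open>quadratic_decay\<close>).

  Thirdly, positivity is invariant under inversion: where \<open>w\<close> satisfies it, so does
  \<open>y \<mapsto> \<bar>y\<bar>\<^sup>2 w(y/\<bar>y\<bar>\<^sup>2)\<close>. If \<open>w x \<le> C \<bar>x\<bar>\<^sup>2\<close>, this function is bounded by \<open>C\<close> at infinity, yet it is
  strictly convex on every line that stays away from the origin; a bounded convex function on a
  whole line is constant (\<open>no_quadratic_decay\<close>). Hence \<open>W 0 > 0\<close>, the extension \<open>W\<close> is bounded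
  below by a positive constant, and \<open>v = W\<^bsup>1/p\<^esup>\<close> is the required extension of \<open>u\<close>.
\<close>

section \<open>Symmetric matrices with positive eigenvalues\<close>

text \<open>
  A minimiser \<open>v\<close> of the quadratic form on the unit sphere of \<open>S\<close> is an eigenvector. For
  \<open>r = A v - c v \<in> S\<close> the function \<open>t \<mapsto> (v + t r) \<bullet> A (v + t r) - c \<bar>v + t r\<bar>\<^sup>2\<close> is
  nonnegative, vanishes at 0 and has slope \<open>2 \<bar>r\<bar>\<^sup>2\<close> there, so \<open>r = 0\<close>. The lemma serves twice: on
  orthogonal complements to build an eigenbasis, and on the whole space to bound the form below.
\<close>

lemma rayleigh_minimum_is_eigenvector:
  fixes A :: "real^'n^'n"
  assumes sym: "transpose A = A" and S: "subspace S" "S \<noteq> {0}"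
    and inv: "\<And>x. x \<in> S \<Longrightarrow> A *v x \<in> S"
  obtains v c where "v \<in> S" "norm v = 1" "A *v v = c *\<^sub>R v"
    "\<And>x. x \<in> S \<Longrightarrow> c * (norm x)\<^sup>2 \<le> x \<bullet> (A *v x)"
proof -
  have lin: "linear ((*v) A)" by simp
  have adj: "x \<bullet> (A *v y) = (A *v x) \<bullet> y" for x y
    by (metis dot_lmul_matrix sym transpose_matrix_vector)
  have "compact (S \<inter> sphere 0 1)"
    using closed_subspace[OF S(1)] compact_sphere by (simp add: closed_Int_compact)
  moreover obtain x where "x \<in> S" "x \<noteq> 0"
    using S subspace_0 by blast
  then have "x /\<^sub>R norm x \<in> S \<inter> sphere 0 1"
    using S(1) by (simp add: subspace_scale)
  then have "S \<inter> sphere 0 1 \<noteq> {}" by blast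
  moreover have "continuous_on (S \<inter> sphere 0 1) (\<lambda>x. x \<bullet> (A *v x))"
    by (intro continuous_intros linear_continuous_on linear_conv_bounded_linear[THEN iffD1] lin)
  ultimately obtain v where v: "v \<in> S" "norm v = 1"
    and min: "\<And>y. y \<in> S \<Longrightarrow> norm y = 1 \<Longrightarrow> v \<bullet> (A *v v) \<le> y \<bullet> (A *v y)"
    using continuous_attains_inf[of "S \<inter> sphere 0 1" "\<lambda>x. x \<bullet> (A *v x)"]
    by (metis IntD1 IntD2 IntI mem_sphere_0)
  define c where "c = v \<bullet> (A *v v)"
  have q: "c * (norm x)\<^sup>2 \<le> x \<bullet> (A *v x)" if "x \<in> S" for x
  proof (cases "x = 0")
    case False
    have "c \<le> (x /\<^sub>R norm x) \<bullet> (A *v (x /\<^sub>R norm x))"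
      unfolding c_def using that False S(1) by (intro min) (auto simp: subspace_scale)
    also have "\<dots> = (x \<bullet> (A *v x)) / (norm x)\<^sup>2"
      using False by (simp add: matrix_vector_mult_scaleR power2_eq_square divide_simps)
    finally show ?thesis
      using False by (simp add: field_simps)
  qed auto
  define r where "r = A *v v - c *\<^sub>R v"
  have rS: "r \<in> S"
    unfolding r_def using S(1) v inv by (simp add: subspace_diff subspace_scale)
  define b where "b = r \<bullet> (A *v r) - c * (norm r)\<^sup>2"
  have ineq: "0 \<le> 2 * t * (norm r)\<^sup>2 + t\<^sup>2 * b" for t
  proof -
    have "v + t *\<^sub>R r \<in> S" using S(1) v rS by (simp add: subspace_add subspace_scale)
    from q[OF this] have "0 \<le> (v + t *\<^sub>R r) \<bullet> (A *v (v + t *\<^sub>R r)) - c * ((v + t *\<^sub>R r) \<bullet> (v + t *\<^sub>R r))"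
      by (simp add: power2_norm_eq_inner)
    also have "\<dots> = (v \<bullet> (A *v v) - c * (v \<bullet> v)) + 2 * t * (r \<bullet> (A *v v) - c * (r \<bullet> v)) + t\<^sup>2 * b"
      unfolding b_def power2_norm_eq_inner
      by (simp add: matrix_vector_right_distrib matrix_vector_mult_scaleR inner_add_left inner_add_right
          adj[of v r] inner_commute[of "A *v v" r] inner_commute[of v r] algebra_simps power2_eq_square)
    also have "v \<bullet> (A *v v) - c * (v \<bullet> v) = 0"
      using v by (simp add: c_def dot_square_norm)
    also have "r \<bullet> (A *v v) - c * (r \<bullet> v) = (norm r)\<^sup>2"
      by (simp add: r_def power2_norm_eq_inner inner_diff_right)
    finally show ?thesis by simp
  qed
  have "r = 0"
  proof (rule ccontr)
    assume "r \<noteq> 0"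
    then have p: "(norm r)\<^sup>2 > 0" by simp
    \<comment> \<open>for this small negative \<open>t\<close> the linear term outweighs the quadratic one\<close>
    define t where "t = - ((norm r)\<^sup>2 / (1 + \<bar>b\<bar>))"
    have "t < 0" using p by (simp add: t_def)
    moreover have "0 \<le> t * (2 * (norm r)\<^sup>2 + t * b)"
      using ineq[of t] by (simp add: algebra_simps power2_eq_square)
    ultimately have "2 * (norm r)\<^sup>2 + t * b \<le> 0"
      by (simp add: zero_le_mult_iff)
    moreover have "\<bar>t * b\<bar> \<le> (norm r)\<^sup>2"
    proof -
      have "\<bar>t * b\<bar> = (norm r)\<^sup>2 * (\<bar>b\<bar> / (1 + \<bar>b\<bar>))" by (simp add: t_def abs_mult abs_divide)
      also have "\<dots> \<le> (norm r)\<^sup>2 * 1" by (intro mult_left_mono) (auto simp: divide_simps)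
      finally show ?thesis by simp
    qed
    ultimately show False using p by linarith
  qed
  then show thesis
    using that[of v c] v q unfolding r_def by simp
qed

text \<open>
  The orthogonal complement of a set of eigenvectors of a symmetric matrix is invariant, so as long
  as it is nonzero the Rayleigh minimum on it supplies a further eigenvector.
\<close>

lemma orthonormal_eigenvectors_exist:
  fixes A :: "real^'n^'n"
  assumes sym: "transpose A = A"
  shows "k \<le> CARD('n) \<Longrightarrow> \<exists>B. finite B \<and> card B = k \<and> pairwise orthogonal B \<and>
    (\<forall>v\<in>B. norm v = 1 \<and> (\<exists>c. A *v v = c *\<^sub>R v))"
proof (induction k)
  case 0
  show ?case by (rule exI[of _ "{}"]) auto
next
  case (Suc k)
  then obtain B where B: "finite B" "card B = k" "pairwise orthogonal B"
    and ev: "\<And>v. v \<in> B \<Longrightarrow> norm v = 1 \<and> (\<exists>c. A *v v = c *\<^sub>R v)" by auto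
  define S where "S = {x. \<forall>b\<in>B. b \<bullet> x = 0}"
  have S: "subspace S"
    unfolding S_def subspace_def by (auto simp: inner_add_right)
  have "dim B < DIM(real^'n)"
    using dim_le_card[of B B] B Suc.prems span_superset[of B] by (simp add: dim_le_card')
  then obtain z where "z \<noteq> 0" "\<And>y. y \<in> span B \<Longrightarrow> orthogonal z y"
    using orthogonal_to_subspace_exists by blast
  then have "z \<in> S"
    by (auto simp: S_def orthogonal_def inner_commute span_base)
  with \<open>z \<noteq> 0\<close> have "S \<noteq> {0}" by auto
  have inv: "A *v x \<in> S" if "x \<in> S" for x
    unfolding S_def
  proof clarify
    fix b assume b: "b \<in> B"
    then obtain c where c: "A *v b = c *\<^sub>R b" using ev by blast
    have "b \<bullet> (A *v x) = (A *v b) \<bullet> x"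
      by (metis dot_lmul_matrix sym transpose_matrix_vector)
    then show "b \<bullet> (A *v x) = 0" using c that b by (simp add: S_def)
  qed
  obtain v c where v: "v \<in> S" "norm v = 1" "A *v v = c *\<^sub>R v"
    using rayleigh_minimum_is_eigenvector[OF sym S \<open>S \<noteq> {0}\<close> inv] by metis
  have "v \<notin> B"
    using v by (auto simp: S_def)
  show ?case
  proof (intro exI conjI)
    show "finite (insert v B)" using B by simp
    show "card (insert v B) = Suc k" using B \<open>v \<notin> B\<close> by simp
    show "pairwise orthogonal (insert v B)"
      using B(3) v(1) by (auto simp: pairwise_insert S_def orthogonal_def inner_commute)
  qed (use ev v in auto)
qed

text \<open>
  The tuple of eigenvalues is selected by a choice operator, so nothing is known about it until the
  characteristic polynomial is shown to split over the reals. An orthonormal eigenbasis,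
  taken as the columns of \<open>P\<close>, diagonalises \<open>t I - A\<close> for all \<open>t\<close> at once.
\<close>

lemma eigenvalues_char_poly:
  fixes A :: "real^'n^'n"
  assumes sym: "transpose A = A"
  shows "det (t *\<^sub>R mat 1 - A) = (\<Prod>i\<in>UNIV. t - eigenvalues A $ i)"
proof -
  obtain B where B: "finite B" "card B = CARD('n)" "pairwise orthogonal B"
    and ev: "\<And>v. v \<in> B \<Longrightarrow> norm v = 1 \<and> (\<exists>c. A *v v = c *\<^sub>R v)"
    using orthonormal_eigenvectors_exist[OF sym, of "CARD('n)"] by auto
  obtain f :: "'n \<Rightarrow> real^'n" where f: "bij_betw f UNIV B"
    using finite_same_card_bij[of "UNIV::'n set" B] B by auto
  then have fB: "f j \<in> B" for j by (auto simp: bij_betw_def)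
  then have "\<forall>j. \<exists>c. A *v f j = c *\<^sub>R f j" using ev by blast
  then obtain l where l: "\<And>j. A *v f j = l j *\<^sub>R f j" by metis
  define P :: "real^'n^'n" where "P = (\<chi> i j. f j $ i)"
  have col: "column j P = f j" for j by (simp add: P_def column_def vec_eq_iff)
  have "orthogonal_matrix P"
    unfolding orthogonal_matrix_orthonormal_columns col
    using ev fB B(3) f by (metis UNIV_I bij_betw_imp_inj_on inj_on_def pairwiseD)
  then have dP: "det P \<noteq> 0" using det_orthogonal_matrix[of P] by auto
  have "det (t *\<^sub>R mat 1 - A) = (\<Prod>i\<in>UNIV. t - l i)" for t
  proof -
    define D :: "real^'n^'n" where "D = (\<chi> i j. if i = j then t - l j else 0)"
    have "(t *\<^sub>R mat 1 - A) ** P = P ** D"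
    proof (simp add: vec_eq_iff, intro allI)
      fix i j
      have "((t *\<^sub>R mat 1 - A) ** P) $ i $ j = ((t *\<^sub>R mat 1 - A) *v f j) $ i"
        by (simp add: matrix_matrix_mult_def matrix_vector_mult_def P_def)
      also have "(t *\<^sub>R mat 1 - A) *v f j = (t - l j) *\<^sub>R f j"
        by (simp add: matrix_vector_mult_diff_rdistrib l algebra_simps
            scaleR_matrix_vector_assoc[symmetric])
      also have "\<dots> $ i = (P ** D) $ i $ j"
        by (simp add: matrix_matrix_mult_def P_def D_def if_distrib cong: if_cong)
      finally show "((t *\<^sub>R mat 1 - A) ** P) $ i $ j = (P ** D) $ i $ j" .
    qed
    then have "det (t *\<^sub>R mat 1 - A) * det P = det P * det D"
      by (metis det_mul)
    then have "det (t *\<^sub>R mat 1 - A) = det D" using dP by simp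
    also have "\<dots> = (\<Prod>i\<in>UNIV. D $ i $ i)"
      by (rule det_diagonal) (simp add: D_def)
    finally show ?thesis by (simp add: D_def)
  qed
  then have "\<exists>l::real^'n. \<forall>t. det (t *\<^sub>R mat 1 - A) = (\<Prod>i\<in>UNIV. t - l $ i)"
    by (intro exI[of _ "\<chi> i. l i"]) simp
  from someI_ex[OF this] show ?thesis
    unfolding eigenvalues_def by blast
qed

text \<open>
  The minimum of the Rayleigh quotient is a root of the characteristic polynomial, hence one of the
  positive numbers \<open>eigenvalues A $ i\<close>.
\<close>

lemma U_n_positive_definite:
  fixes A :: "real^'n^'n"
  assumes "A \<in> U_n" "x \<noteq> 0"
  shows "0 < x \<bullet> (A *v x)"
proof -
  have sym: "transpose A = A" and pos: "\<And>i. eigenvalues A $ i > 0"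
    using assms by (auto simp: U_n_def Gamma_n_def)
  obtain v c where v: "norm v = 1" "A *v v = c *\<^sub>R v"
    and q: "c * (norm x)\<^sup>2 \<le> x \<bullet> (A *v x)"
    using rayleigh_minimum_is_eigenvector[OF sym subspace_UNIV] assms(2) by (metis UNIV_I singletonD)
  have "(c *\<^sub>R mat 1 - A) *v v = 0"
    using v by (simp add: matrix_vector_mult_diff_rdistrib algebra_simps
            scaleR_matrix_vector_assoc[symmetric])
  moreover have "v \<noteq> 0" using v by auto
  ultimately have "det (c *\<^sub>R mat 1 - A) = 0"
    using det_nz_iff_inj[of "(*v) (c *\<^sub>R mat 1 - A)"] vec.inj_iff_eq_0
    by (metis invertible_det_nz invertible_left_inverse matrix_left_invertible_ker)
  then obtain i where "c = eigenvalues A $ i"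
    unfolding eigenvalues_char_poly[OF sym] by auto
  then have "0 < c" using pos by simp
  then have "0 < c * (norm x)\<^sup>2" using assms(2) by simp
  with q show ?thesis by linarith
qed

section \<open>Positive conformal Hessian around a puncture\<close>

text \<open>
  Here \<open>G\<close> is the gradient of \<open>w\<close> and \<open>S x\<close> its Hessian at \<open>x\<close>; the last assumption is
  positive definiteness of \<open>w \<nabla>\<^sup>2w - \<bar>\<nabla>w\<bar>\<^sup>2/2 I\<close>.
\<close>

locale punctured_conformal_factor =
  fixes w :: "'a::euclidean_space \<Rightarrow> real" and G :: "'a \<Rightarrow> 'a" and S :: "'a \<Rightarrow> 'a \<Rightarrow> 'a"
  assumes dim: "2 \<le> DIM('a)"
    and pos: "x \<in> ball 0 2 - {0} \<Longrightarrow> 0 < w x"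
    and dw: "x \<in> ball 0 2 - {0} \<Longrightarrow> (w has_derivative (\<lambda>k. G x \<bullet> k)) (at x)"
    and dG: "x \<in> ball 0 2 - {0} \<Longrightarrow> (G has_derivative S x) (at x)"
    and ell: "x \<in> ball 0 2 - {0} \<Longrightarrow> k \<noteq> 0 \<Longrightarrow>
        (norm (G x))\<^sup>2 * (norm k)\<^sup>2 / 2 < w x * (k \<bullet> S x k)"
begin

lemma hessian_nonneg: "x \<in> ball 0 2 - {0} \<Longrightarrow> 0 \<le> k \<bullet> S x k"
proof (cases "k = 0")
  case False
  assume x: "x \<in> ball 0 2 - {0}"
  have "0 \<le> (norm (G x))\<^sup>2 * (norm k)\<^sup>2 / 2" by simp
  with ell[OF x False] have "0 < w x * (k \<bullet> S x k)" by linarith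
  then show ?thesis using pos[OF x] by (simp add: zero_less_mult_iff)
qed simp

lemma DERIV_along:
  assumes c: "(c has_vector_derivative c') (at t)" and x: "c t \<in> ball 0 2 - {0}"
  shows "((\<lambda>s. w (c s)) has_real_derivative G (c t) \<bullet> c') (at t)"
    and "((\<lambda>s. G (c s)) has_vector_derivative S (c t) c') (at t)"
proof -
  have "((\<lambda>s. w (c s)) has_derivative (\<lambda>h. G (c t) \<bullet> (h *\<^sub>R c'))) (at t)"
    by (rule has_derivative_compose[OF c[unfolded has_vector_derivative_def] dw[OF x]])
  then show "((\<lambda>s. w (c s)) has_real_derivative G (c t) \<bullet> c') (at t)"
    unfolding has_field_derivative_def by (rule has_derivative_eq_rhs) (simp add: fun_eq_iff)
  have "((\<lambda>s. G (c s)) has_derivative (\<lambda>h. S (c t) (h *\<^sub>R c'))) (at t)"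
    by (rule has_derivative_compose[OF c[unfolded has_vector_derivative_def] dG[OF x]])
  then show "((\<lambda>s. G (c s)) has_vector_derivative S (c t) c') (at t)"
    unfolding has_vector_derivative_def
    using linear_cmul[OF has_derivative_linear[OF dG[OF x]]] by simp
qed

lemma DERIV_along_line:
  assumes "x + t *\<^sub>R d \<in> ball 0 2 - {0}"
  shows "((\<lambda>s. w (x + s *\<^sub>R d)) has_real_derivative G (x + t *\<^sub>R d) \<bullet> d) (at t)"
    and "((\<lambda>s. G (x + s *\<^sub>R d) \<bullet> d) has_real_derivative d \<bullet> S (x + t *\<^sub>R d) d) (at t)"
proof -
  have c: "((\<lambda>s. x + s *\<^sub>R d) has_vector_derivative d) (at t)"
    by (auto intro!: derivative_eq_intros)
  show "((\<lambda>s. w (x + s *\<^sub>R d)) has_real_derivative G (x + t *\<^sub>R d) \<bullet> d) (at t)"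
    by (rule DERIV_along[OF c assms])
  have "((\<lambda>s. G (x + s *\<^sub>R d) \<bullet> d) has_vector_derivative S (x + t *\<^sub>R d) d \<bullet> d) (at t)"
    by (rule bounded_linear.has_vector_derivative[OF bounded_linear_inner_left DERIV_along(2)[OF c assms]])
  then show "((\<lambda>s. G (x + s *\<^sub>R d) \<bullet> d) has_real_derivative d \<bullet> S (x + t *\<^sub>R d) d) (at t)"
    by (simp add: has_real_derivative_iff_has_vector_derivative inner_commute)
qed

text \<open>
  On a segment that misses the origin this is convexity in one variable. If the segment from \<open>x\<close> to
  \<open>z\<close> meets the origin, both points lie on one line; moving \<open>z\<close> in a direction \<open>e\<close> orthogonal to
  that line makes the segment miss the origin, and the inequality passes to the limit.
\<close>

lemma tangent_below:
  assumes x: "x \<in> ball 0 2 - {0}" and z: "z \<in> ball 0 2 - {0}"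
  shows "w x + G x \<bullet> (z - x) \<le> w z"
proof -
  have seg: "w x + G x \<bullet> (z - x) \<le> w z"
    if z: "z \<in> ball 0 2" and "0 \<notin> closed_segment x z" for z
  proof -
    have in_seg: "x + t *\<^sub>R (z - x) \<in> ball 0 2 - {0}" if t: "t \<in> {0..1}" for t
    proof -
      have "x + t *\<^sub>R (z - x) \<in> closed_segment x z"
        using t by (auto simp: in_segment algebra_simps intro!: exI[of _ t])
      moreover have "closed_segment x z \<subseteq> ball 0 2"
        using x z by (intro closed_segment_subset) auto
      ultimately show ?thesis using that \<open>0 \<notin> closed_segment x z\<close> by auto
    qed
    have "G (x + 0 *\<^sub>R (z - x)) \<bullet> (z - x) * (1 - 0) \<le> w (x + 1 *\<^sub>R (z - x)) - w (x + 0 *\<^sub>R (z - x))"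
      by (rule f''_imp_f'[where C = "{0..1}" and f = "\<lambda>t. w (x + t *\<^sub>R (z - x))",
            OF _ DERIV_along_line(1) DERIV_along_line(2) hessian_nonneg])
         (use in_seg in auto)
    then show ?thesis by simp
  qed
  show ?thesis
  proof (cases "0 \<in> closed_segment x z")
    case False
    then show ?thesis using seg z by auto
  next
    case True
    then obtain s where s: "0 \<le> s" "s \<le> 1" "0 = (1 - s) *\<^sub>R x + s *\<^sub>R z"
      by (auto simp: in_segment)
    obtain e where e: "e \<noteq> 0" "orthogonal x e"
      using orthogonal_to_vector_exists[OF dim] by metis
    have "s *\<^sub>R z = - ((1 - s) *\<^sub>R x)" using s by (simp add: add_eq_0_iff)
    moreover have "s \<noteq> 0" using s x by auto
    ultimately have ze: "z \<bullet> e = 0"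
      using e by (metis inner_scaleR_left inner_minus_left mult_eq_0_iff neg_0_equal_iff_equal orthogonal_def)
    have avoid: "0 \<notin> closed_segment x (z + d *\<^sub>R e)" if "d \<noteq> 0" for d
    proof
      assume "0 \<in> closed_segment x (z + d *\<^sub>R e)"
      then obtain r where r: "0 = (1 - r) *\<^sub>R x + r *\<^sub>R (z + d *\<^sub>R e)" by (auto simp: in_segment)
      then have "0 = ((1 - r) *\<^sub>R x + r *\<^sub>R (z + d *\<^sub>R e)) \<bullet> e" by simp
      then have "r * d * (e \<bullet> e) = 0"
        using e(2) ze by (simp add: inner_add_left orthogonal_def)
      with \<open>d \<noteq> 0\<close> e r x show False by auto
    qed
    have lim: "((\<lambda>d. z + d *\<^sub>R e) \<longlongrightarrow> z) (at 0)"
      by (auto intro!: tendsto_eq_intros)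
    have "\<forall>\<^sub>F d in at (0::real). z + d *\<^sub>R e \<in> ball 0 2"
      by (rule topological_tendstoD[OF lim open_ball]) (use z in auto)
    then have "\<forall>\<^sub>F d in at 0. w x + G x \<bullet> ((z + d *\<^sub>R e) - x) \<le> w (z + d *\<^sub>R e)"
      by (auto simp: eventually_at_filter elim!: eventually_mono intro!: seg avoid)
    moreover have "((\<lambda>d. w (z + d *\<^sub>R e)) \<longlongrightarrow> w z) (at 0)"
      by (rule isCont_tendsto_compose[OF has_derivative_continuous[OF dw[OF z]] lim])
    moreover have "((\<lambda>d. w x + G x \<bullet> ((z + d *\<^sub>R e) - x)) \<longlongrightarrow> w x + G x \<bullet> (z - x)) (at 0)"
      by (intro tendsto_intros lim)
    ultimately show ?thesis
      by (rule_tac tendsto_le[OF at_neq_bot]) auto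
  qed
qed

lemma continuous_w: "continuous_on (ball 0 2 - {0}) w"
  using has_derivative_continuous[OF dw] by (intro continuous_at_imp_continuous_on) blast

text \<open>
  From a point \<open>x\<close> of the unit ball, follow the direction of \<open>\<nabla>w\<close> up to the sphere of radius
  3/2, at a distance of at least 1/2. The tangent plane at \<open>x\<close> stays below \<open>w\<close>, which is at
  most \<open>M\<close> on that sphere and positive at \<open>x\<close>, so \<open>\<bar>\<nabla>w\<bar> \<le> 2 M\<close>. With the gradient bounded, the
  tangent inequality between two points is the Lipschitz estimate.
\<close>

lemma lipschitz_near_puncture:
  obtains L where "L-lipschitz_on (cball 0 1 - {0}) w"
proof -
  have sub: "sphere (0::'a) (3/2) \<subseteq> ball 0 2 - {0}" by auto
  have "compact (w ` sphere 0 (3/2))"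
    using continuous_on_subset[OF continuous_w sub] by (intro compact_continuous_image) auto
  then obtain M where M: "\<And>y. norm y = 3/2 \<Longrightarrow> w y \<le> M"
    using bounded_imp_bdd_above[OF compact_imp_bounded] by (fastforce simp: bdd_above_def)
  have G: "norm (G x) \<le> 2 * \<bar>M\<bar>" if x: "x \<in> cball 0 1 - {0}" for x
  proof (cases "G x = 0")
    case False
    define e where "e = G x /\<^sub>R norm (G x)"
    have ne: "norm e = 1" using False by (simp add: e_def)
    have Ge: "G x \<bullet> e = norm (G x)"
      using False by (simp add: e_def dot_square_norm power2_eq_square)
    have "\<exists>t\<ge>0. t \<le> 5/2 \<and> norm (x + t *\<^sub>R e) = 3/2"
    proof (rule IVT')
      show "norm (x + 0 *\<^sub>R e) \<le> 3/2" using x by auto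
      have "norm ((x + (5/2) *\<^sub>R e) - x) \<le> norm (x + (5/2) *\<^sub>R e) + norm x"
        by (rule norm_triangle_ineq4)
      then show "3/2 \<le> norm (x + (5/2) *\<^sub>R e)" using ne x by simp
    qed (auto intro!: continuous_intros)
    then obtain t where t: "0 \<le> t" "norm (x + t *\<^sub>R e) = 3/2" by blast
    have "t \<ge> 1/2" using norm_triangle_ineq[of x "t *\<^sub>R e"] t ne x by simp
    have "w x + G x \<bullet> ((x + t *\<^sub>R e) - x) \<le> w (x + t *\<^sub>R e)"
      using x t(2) by (intro tangent_below) auto
    then have "t * norm (G x) \<le> w (x + t *\<^sub>R e) - w x" using Ge by simp
    moreover have "0 < w x" using x by (intro pos) auto
    ultimately have "t * norm (G x) \<le> M" using M[OF t(2)] by linarith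
    moreover have "1/2 * norm (G x) \<le> t * norm (G x)"
      using \<open>t \<ge> 1/2\<close> by (intro mult_right_mono) auto
    ultimately show ?thesis by linarith
  qed simp
  have *: "w x - w y \<le> 2 * \<bar>M\<bar> * dist x y"
    if x: "x \<in> cball 0 1 - {0}" and y: "y \<in> cball 0 1 - {0}" for x y
  proof -
    have "w x + G x \<bullet> (y - x) \<le> w y" using x y by (intro tangent_below) auto
    moreover have "- (G x \<bullet> (y - x)) \<le> norm (G x) * norm (y - x)"
      using Cauchy_Schwarz_ineq2[of "G x" "y - x"] by linarith
    moreover have "\<dots> \<le> 2 * \<bar>M\<bar> * dist x y"
      using G[OF x] by (simp add: dist_norm norm_minus_commute mult_right_mono)
    ultimately show ?thesis by linarith
  qed
  have "(2 * \<bar>M\<bar>)-lipschitz_on (cball 0 1 - {0}) w"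
  proof (rule lipschitz_onI)
    fix x y :: 'a assume "x \<in> cball 0 1 - {0}" "y \<in> cball 0 1 - {0}"
    with *[of x y] *[of y x] show "dist (w x) (w y) \<le> 2 * \<bar>M\<bar> * dist x y"
      by (simp add: dist_real_def dist_commute abs_le_iff)
  qed simp
  then show thesis by (rule that)
qed

text \<open>
  Along the ray through a unit vector \<open>e\<close>, the function \<open>h s = sqrt (w (s e))\<close> is convex on
  \<open>(0,1]\<close> and tends to 0 at 0. Hence \<open>h r \<le> r h 1\<close>; squaring gives the claim, with \<open>C\<close> a
  bound for \<open>w\<close> on the unit sphere.
\<close>

lemma quadratic_decay:
  assumes "(w \<longlongrightarrow> 0) (at 0)"
  obtains C where "\<And>x. x \<in> cball 0 1 - {0} \<Longrightarrow> w x \<le> C * (norm x)\<^sup>2"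
proof -
  have sub: "sphere (0::'a) 1 \<subseteq> ball 0 2 - {0}" by auto
  have "compact (w ` sphere 0 1)"
    using continuous_on_subset[OF continuous_w sub] by (intro compact_continuous_image) auto
  then obtain C where C: "\<And>y. norm y = 1 \<Longrightarrow> w y \<le> C"
    using bounded_imp_bdd_above[OF compact_imp_bounded] by (fastforce simp: bdd_above_def)
  have "w x \<le> C * (norm x)\<^sup>2" if x: "x \<in> cball 0 1 - {0}" for x
  proof -
    define e where "e = x /\<^sub>R norm x"
    define r where "r = norm x"
    have r: "0 < r" "r \<le> 1" and ne: "norm e = 1" and xe: "x = r *\<^sub>R e"
      using x by (auto simp: e_def r_def)
    define f where "f = (\<lambda>s. w (s *\<^sub>R e))"
    define f' where "f' = (\<lambda>s. G (s *\<^sub>R e) \<bullet> e)"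
    define f'' where "f'' = (\<lambda>s. e \<bullet> S (s *\<^sub>R e) e)"
    define h where "h = (\<lambda>s. sqrt (f s))"
    define h' where "h' = (\<lambda>s. f' s / (2 * sqrt (f s)))"
    define h'' where "h'' = (\<lambda>s. (2 * f s * f'' s - (f' s)\<^sup>2) / (4 * f s * sqrt (f s)))"
    have dom: "s *\<^sub>R e \<in> ball 0 2 - {0}" if "s \<in> {0<..1}" for s
      using that ne by auto
    have fpos: "0 < f s" if "s \<in> {0<..1}" for s
      unfolding f_def by (rule pos[OF dom[OF that]])
    have df: "(f has_real_derivative f' s) (at s)" "(f' has_real_derivative f'' s) (at s)"
      if "s \<in> {0<..1}" for s
      unfolding f_def f'_def f''_def using DERIV_along_line[of 0 s e] dom[OF that] by simp_all
    have dh: "(h has_real_derivative h' s) (at s)" if s: "s \<in> {0<..1}" for s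
      unfolding h_def h'_def using fpos[OF s]
      by (auto intro!: derivative_eq_intros df(1)[OF s] simp: field_simps)
    have dh': "(h' has_real_derivative h'' s) (at s)" if s: "s \<in> {0<..1}" for s
    proof -
      have [simp]: "sqrt (f s) * sqrt (f s) = f s" using fpos[OF s] by simp
      have "(h' has_real_derivative (f'' s * (2 * sqrt (f s)) - f' s * (2 * (f' s / (2 * sqrt (f s)))))
               / ((2 * sqrt (f s)) * (2 * sqrt (f s)))) (at s)"
        unfolding h'_def using fpos[OF s]
        by (intro DERIV_divide DERIV_cmult df[OF s] dh[OF s, unfolded h_def h'_def]) auto
      also have "(f'' s * (2 * sqrt (f s)) - f' s * (2 * (f' s / (2 * sqrt (f s)))))
               / ((2 * sqrt (f s)) * (2 * sqrt (f s))) = h'' s"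
        unfolding h''_def using fpos[OF s] by (simp add: divide_simps power2_eq_square algebra_simps)
      finally show ?thesis .
    qed
    have h''0: "0 \<le> h'' s" if s: "s \<in> {0<..1}" for s
    proof -
      have "(f' s)\<^sup>2 \<le> (norm (G (s *\<^sub>R e)))\<^sup>2"
        using Cauchy_Schwarz_ineq2[of "G (s *\<^sub>R e)" e] ne
        by (simp add: f'_def abs_le_square_iff[symmetric])
      also have "\<dots> < 2 * f s * f'' s"
        using ell[OF dom[OF s], of e] ne by (cases "e = 0") (auto simp: f_def f''_def mult_ac)
      finally show ?thesis using fpos[OF s] by (simp add: h''_def)
    qed
    have tan: "h' a * (b - a) \<le> h b - h a" if "a \<in> {0<..1}" "b \<in> {0<..1}" for a b
      by (rule f''_imp_f'[OF _ dh dh' h''0 that]) auto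
    have lim: "(h \<longlongrightarrow> 0) (at_right 0)"
    proof -
      have "filterlim (\<lambda>s. s *\<^sub>R e) (at 0) (at_right 0)"
        unfolding filterlim_at
      proof
        show "\<forall>\<^sub>F s in at_right 0. s *\<^sub>R e \<in> UNIV \<and> s *\<^sub>R e \<noteq> 0"
          using eventually_at_right_less[of 0] by eventually_elim (use ne in auto)
      qed (auto intro!: tendsto_eq_intros)
      from filterlim_compose[OF assms this] have "(f \<longlongrightarrow> 0) (at_right 0)" by (simp add: f_def)
      from tendsto_real_sqrt[OF this] show ?thesis by (simp add: h_def)
    qed
    \<comment> \<open>\<open>h\<close> is given on \<open>(0,1]\<close> only, so its tangent at \<open>r\<close> is compared with its limit at 0\<close>
    have "h' r * (0 - r) \<le> 0 - h r"
    proof (rule tendsto_le[OF trivial_limit_at_right_real])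
      show "((\<lambda>b. h b - h r) \<longlongrightarrow> 0 - h r) (at_right 0)" by (intro tendsto_intros lim)
      show "((\<lambda>b. h' r * (b - r)) \<longlongrightarrow> h' r * (0 - r)) (at_right 0)" by (intro tendsto_intros)
      show "\<forall>\<^sub>F b in at_right 0. h' r * (b - r) \<le> h b - h r"
        using eventually_at_right_real[of 0 1, OF zero_less_one]
        by eventually_elim (use r in \<open>auto intro!: tan\<close>)
    qed
    then have 1: "h r \<le> r * h' r" by (simp add: algebra_simps)
    have 2: "h' r * (1 - r) \<le> h 1 - h r" by (rule tan) (use r in auto)
    have "h r = h r * (1 - r) + r * h r" by (simp add: algebra_simps)
    also have "\<dots> \<le> (r * h' r) * (1 - r) + r * h r"
      using 1 r by (intro add_right_mono mult_right_mono) auto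
    also have "\<dots> = r * (h' r * (1 - r)) + r * h r" by (simp add: algebra_simps)
    also have "\<dots> \<le> r * (h 1 - h r) + r * h r"
      using 2 r by (intro add_right_mono mult_left_mono) auto
    finally have "h r \<le> r * h 1" by (simp add: algebra_simps)
    moreover have "0 \<le> h r" using fpos[of r] r by (simp add: h_def less_imp_le)
    ultimately have "(h r)\<^sup>2 \<le> (r * h 1)\<^sup>2" by (rule power_mono)
    then have "f r \<le> r\<^sup>2 * f 1"
      using fpos[of r] fpos[of 1] r by (simp add: h_def power_mult_distrib)
    also have "\<dots> \<le> r\<^sup>2 * C" using C[OF ne] by (intro mult_left_mono) (auto simp: f_def)
    finally show ?thesis unfolding f_def xe[symmetric] by (simp add: r_def mult.commute)
  qed
  then show thesis by (rule that)
qed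

text \<open>
  Let \<open>t \<mapsto> y + t v\<close> be a line at distance 1 from the origin, \<open>q t\<close> the squared norm of its
  points and \<open>X = (y + t v)/q\<close> their inversions, which trace a circle through the origin. The
  vector \<open>e = v - 2 t X\<close> has norm 1, \<open>X' = e/q\<close>, and \<open>g = q w(X)\<close> satisfies
  \<open>g' = 2 t w + \<nabla>w \<bullet> e\<close> and \<open>g'' = 2 w - 2 \<nabla>w \<bullet> X + (e \<bullet> \<nabla>\<^sup>2w e)/q\<close>. Since
  \<open>\<bar>X\<bar>\<^sup>2 = 1/q\<close>, the lower bound for \<open>\<nabla>\<^sup>2w\<close> completes a square:
  \<open>2 w g'' > q \<bar>2 w X - \<nabla>w/q\<bar>\<^sup>2 \<ge> 0\<close>. So \<open>g\<close> is strictly convex on the whole line and takes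
  values between 0 and \<open>C\<close>, which is impossible.
\<close>

lemma no_quadratic_decay:
  assumes C: "\<And>x. x \<in> cball 0 1 - {0} \<Longrightarrow> w x \<le> C * (norm x)\<^sup>2"
  shows False
proof -
  obtain v :: 'a where v: "norm v = 1"
    using norm_Basis nonempty_Basis by blast
  obtain y' where y': "y' \<noteq> 0" "orthogonal v y'"
    using orthogonal_to_vector_exists[OF dim] by metis
  define y where "y = y' /\<^sub>R norm y'"
  have y: "norm y = 1" "v \<bullet> y = 0" using y' by (simp_all add: y_def orthogonal_def)
  have yy: "y \<bullet> y = 1" "v \<bullet> v = 1" "y \<bullet> v = 0"
    using y v by (simp_all add: dot_square_norm inner_commute)
  define q where "q = (\<lambda>t::real. 1 + t\<^sup>2)"
  have q: "1 \<le> q t" "q t \<noteq> 0" "0 < q t" for t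
    using zero_le_power2[of t] unfolding q_def by linarith+
  define X where "X = (\<lambda>t. (1 / q t) *\<^sub>R (y + t *\<^sub>R v))"
  define e where "e = (\<lambda>t. v - (2 * t) *\<^sub>R X t)"
  have XX: "X t \<bullet> X t = 1 / q t" for t
  proof -
    have "(y + t *\<^sub>R v) \<bullet> (y + t *\<^sub>R v) = q t"
      by (simp add: inner_add_left inner_add_right yy y q_def power2_eq_square)
    then have "X t \<bullet> X t = (1 / q t)\<^sup>2 * q t"
      by (simp add: X_def power2_eq_square)
    then show ?thesis using q by (simp add: power2_eq_square)
  qed
  have vX: "v \<bullet> X t = t / q t" for t
    by (simp add: X_def inner_add_right yy y)
  have ee: "e t \<bullet> e t = 1" for t
    using q[of t]
    by (simp add: e_def inner_diff_left inner_diff_right XX vX inner_commute[of "X t" v] yy)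
  have nX: "X t \<in> cball 0 1 - {0}" for t
  proof -
    have "(norm (X t))\<^sup>2 = 1 / q t" using XX by (simp add: power2_norm_eq_inner)
    moreover have "1 / q t \<le> 1" using q[of t] by simp
    ultimately have "norm (X t) \<le> 1" by (metis abs_norm_cancel abs_square_le_1)
    moreover have "X t \<noteq> 0" using XX[of t] q[of t] by auto
    ultimately show ?thesis by simp
  qed
  have dom: "X t \<in> ball 0 2 - {0}" for t using nX[of t] by auto
  have dX: "(X has_vector_derivative (1 / q t) *\<^sub>R e t) (at t)" for t
  proof -
    have "(X has_vector_derivative (1 / q t) *\<^sub>R v + (- (2 * t) / (q t)\<^sup>2) *\<^sub>R (y + t *\<^sub>R v)) (at t)"
      unfolding X_def
      by (rule has_vector_derivative_scaleR)
         (use q[of t] in \<open>auto intro!: derivative_eq_intros simp: q_def power2_eq_square\<close>)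
    also have "(1 / q t) *\<^sub>R v + (- (2 * t) / (q t)\<^sup>2) *\<^sub>R (y + t *\<^sub>R v) = (1 / q t) *\<^sub>R e t"
      by (simp add: e_def X_def power2_eq_square scaleR_diff_right scaleR_left_commute)
    finally show ?thesis .
  qed
  define g where "g = (\<lambda>t. q t * w (X t))"
  define g' where "g' = (\<lambda>t. 2 * t * w (X t) + G (X t) \<bullet> e t)"
  define g'' where "g'' = (\<lambda>t. 2 * w (X t) - 2 * (G (X t) \<bullet> X t) + (e t \<bullet> S (X t) (e t)) / q t)"
  note dwX = DERIV_along(1)[OF dX dom]
  note dGX = DERIV_along(2)[OF dX dom]
  have Slin: "S (X t) (c *\<^sub>R k) = c *\<^sub>R S (X t) k" for t c k
    using linear_cmul[OF has_derivative_linear[OF dG[OF dom]]] .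
  have dg: "(g has_real_derivative g' t) (at t)" for t
  proof -
    have dq: "(q has_real_derivative 2 * t) (at t)"
      unfolding q_def by (auto intro!: derivative_eq_intros)
    show ?thesis unfolding g_def g'_def
      using DERIV_mult[OF dq dwX] q[of t] by (simp add: algebra_simps)
  qed
  have dg': "(g' has_real_derivative g'' t) (at t)" for t
  proof -
    have de: "(e has_vector_derivative - (2 *\<^sub>R X t + (2 * t / q t) *\<^sub>R e t)) (at t)"
      unfolding e_def
      by (rule derivative_eq_intros dX refl | simp add: e_def)+
    have 1: "((\<lambda>t. G (X t) \<bullet> e t) has_real_derivative
        G (X t) \<bullet> (- (2 *\<^sub>R X t + (2 * t / q t) *\<^sub>R e t)) + S (X t) ((1 / q t) *\<^sub>R e t) \<bullet> e t) (at t)"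
      using bounded_bilinear.has_vector_derivative[OF bounded_bilinear_inner dGX de]
      by (simp add: has_real_derivative_iff_has_vector_derivative)
    have 2: "((\<lambda>t. 2 * t * w (X t)) has_real_derivative 2 * w (X t) + (G (X t) \<bullet> ((1 / q t) *\<^sub>R e t)) * (2 * t)) (at t)"
      by (rule DERIV_mult[OF _ dwX]) (auto intro!: derivative_eq_intros)
    show ?thesis unfolding g'_def g''_def
      using DERIV_add[OF 2 1] by (simp add: Slin inner_add_right inner_commute algebra_simps)
  qed
  have g''pos: "0 < g'' t" for t
  proof -
    let ?w = "w (X t)" and ?G = "G (X t)"
    have w: "0 < ?w" by (rule pos[OF dom])
    have "e t \<noteq> 0" using ee[of t] by auto
    from ell[OF dom[of t] this] have "(?G \<bullet> ?G) < 2 * ?w * (e t \<bullet> S (X t) (e t))"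
      using ee[of t] by (simp add: power2_norm_eq_inner)
    then have A: "(?G \<bullet> ?G) / q t < 2 * ?w * (e t \<bullet> S (X t) (e t)) / q t"
      using q[of t] by (simp add: divide_strict_right_mono)
    have "0 \<le> q t * (((2 * ?w) *\<^sub>R X t - (1 / q t) *\<^sub>R ?G) \<bullet> ((2 * ?w) *\<^sub>R X t - (1 / q t) *\<^sub>R ?G))"
      using q[of t] by simp
    also have "\<dots> = 4 * ?w\<^sup>2 - 4 * ?w * (?G \<bullet> X t) + (?G \<bullet> ?G) / q t"
      using q[of t] by (simp add: inner_diff_left inner_diff_right XX inner_commute[of "X t" ?G]
          power2_eq_square field_simps)
    also have "\<dots> < 4 * ?w\<^sup>2 - 4 * ?w * (?G \<bullet> X t) + 2 * ?w * (e t \<bullet> S (X t) (e t)) / q t"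
      using A by simp
    also have "\<dots> = 2 * ?w * g'' t"
      by (simp add: g''_def power2_eq_square algebra_simps)
    finally show ?thesis using w by (simp add: zero_less_mult_iff)
  qed
  have gC: "0 < g t" "g t \<le> C" for t
  proof -
    have "w (X t) \<le> C * (1 / q t)"
      using C[OF nX[of t]] XX[of t] by (simp add: power2_norm_eq_inner)
    then show "g t \<le> C" using q[of t] by (simp add: g_def field_simps)
    show "0 < g t" using q[of t] pos[OF dom[of t]] by (simp add: g_def)
  qed
  have tan: "g' t * (s - t) \<le> g s - g t" for s t
    by (rule f''_imp_f'[OF convex_UNIV dg dg']) (auto intro: less_imp_le g''pos)
  have "g' t = 0" for t
  proof (rule ccontr)
    assume "g' t \<noteq> 0"
    \<comment> \<open>the tangent at \<open>t\<close> rises by \<open>C\<close> up to this point, above the bound for \<open>g\<close>\<close>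
    then have "g' t * ((t + C / g' t) - t) = C" by simp
    with tan[of t "t + C / g' t"] gC[of t] gC[of "t + C / g' t"] show False by linarith
  qed
  then have "g' = (\<lambda>_. 0)" by auto
  with dg'[of 0] have "g'' 0 = 0" by (metis DERIV_const DERIV_unique)
  with g''pos[of 0] show False by simp
qed

theorem positive_lipschitz_extension:
  obtains W L m where "L-lipschitz_on (cball 0 1) W" "0 < m"
    "\<And>x. x \<in> cball 0 1 \<Longrightarrow> m \<le> W x" "\<And>x. x \<in> cball 0 1 - {0} \<Longrightarrow> W x = w x"
proof -
  obtain L where L: "L-lipschitz_on (cball 0 1 - {0}) w"
    using lipschitz_near_puncture by blast
  have cl: "closure (cball (0::'a) 1 - {0}) = cball 0 1"
  proof
    show "closure (cball (0::'a) 1 - {0}) \<subseteq> cball 0 1" by (intro closure_minimal) auto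
    have "at (0::'a) within cball 0 1 = at 0" by (intro at_within_interior) simp
    then have "0 \<in> closure (cball (0::'a) 1 - {0})" by (metis Diff_idemp at_neq_bot at_within_eq_bot_iff)
    then show "cball (0::'a) 1 \<subseteq> closure (cball 0 1 - {0})"
      using closure_subset[of "cball (0::'a) 1 - {0}"] by blast
  qed
  obtain W where W: "L-lipschitz_on (cball 0 1) W" "\<And>x. x \<in> cball 0 1 - {0} \<Longrightarrow> W x = w x"
    using lipschitz_extend_closure[OF L] unfolding cl by metis
  have cont: "continuous_on (cball 0 1) W" by (rule lipschitz_on_continuous_on[OF W(1)])
  have lim: "(w \<longlongrightarrow> W 0) (at 0)"
  proof -
    have "isCont W 0" using cont continuous_on_interior[of "cball 0 1" W 0] by simp
    then have "(W \<longlongrightarrow> W 0) (at 0)" by (simp add: isCont_def)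
    moreover have "\<forall>\<^sub>F x in at 0. W x = w x"
      using W(2) by (auto simp: eventually_at intro!: exI[of _ 1])
    ultimately show ?thesis by (rule Lim_transform_eventually)
  qed
  have "W 0 \<noteq> 0"
    using lim quadratic_decay no_quadratic_decay by metis
  moreover have "0 \<le> W 0"
    by (rule tendsto_lowerbound[OF lim])
       (auto simp: eventually_at intro!: exI[of _ 2] less_imp_le pos)
  ultimately have "0 < W x" if "x \<in> cball 0 1" for x
    using W(2)[of x] pos[of x] that by (cases "x = 0") auto
  moreover obtain x0 where "x0 \<in> cball 0 1" "\<And>x. x \<in> cball 0 1 \<Longrightarrow> W x0 \<le> W x"
    using continuous_attains_inf[OF compact_cball _ cont] by fastforce
  ultimately show thesis using that[OF W(1), of "W x0"] W(2) by blast
qed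

end

section \<open>The removable singularity\<close>

lemma has_derivative_gradient:
  fixes u :: "'a::euclidean_space \<Rightarrow> real"
  assumes "u differentiable (at x)"
  shows "(u has_derivative (\<lambda>h. gradient u x \<bullet> h)) (at x)"
proof -
  obtain f where f: "(u has_derivative f) (at x)" using assms by (auto simp: differentiable_def)
  have "f h = h \<bullet> adjoint f 1" for h
    using adjoint_works[OF has_derivative_linear[OF f], of h 1] by simp
  then have "f = (\<lambda>h. h \<bullet> adjoint f 1)" by (rule ext)
  then have D: "GDERIV u x :> adjoint f 1" using f by (simp add: gderiv_def)
  have unique: "D = adjoint f 1" if "GDERIV u x :> D" for D
  proof -
    have "(\<lambda>h. h \<bullet> D) = (\<lambda>h. h \<bullet> adjoint f 1)"
      using that D unfolding gderiv_def by (rule has_derivative_unique)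
    then have "\<forall>h. h \<bullet> D = h \<bullet> adjoint f 1" by (simp add: fun_eq_iff)
    then show ?thesis by (rule vector_eq_ldot[THEN iffD1])
  qed
  have "gradient u x = adjoint f 1"
    unfolding gradient_def using D unique by (rule the_equality)
  then have "f = (\<lambda>h. gradient u x \<bullet> h)"
    using \<open>f = (\<lambda>h. h \<bullet> adjoint f 1)\<close> by (simp only: inner_commute[of _ "adjoint f 1"])
  with f show ?thesis by simp
qed

lemma powr_lipschitz_on:
  fixes a m :: real
  assumes m: "0 < m" and a: "a \<le> 1"
  shows "(\<bar>a\<bar> * m powr (a - 1))-lipschitz_on {m..} (\<lambda>x. x powr a)"
proof (rule bounded_derivative_imp_lipschitz)
  fix x assume x: "x \<in> {m..}"
  show "((\<lambda>x. x powr a) has_derivative (*) (a * x powr (a - 1))) (at x within {m..})"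
    using x m has_real_derivative_powr[of x a]
    by (auto simp: has_field_derivative_def intro: has_derivative_at_withinI)
  have "x powr (a - 1) \<le> m powr (a - 1)"
    using x m a by (intro powr_mono2') auto
  then show "onorm ((*) (a * x powr (a - 1))) \<le> \<bar>a\<bar> * m powr (a - 1)"
    by (intro onorm_le) (simp add: abs_mult mult_left_mono mult_right_mono)
qed auto

text \<open>
  The change of unknown \<open>w = u\<^sup>p\<close>: the two vectors on the right that involve powers of \<open>u\<close> are
  \<open>\<nabla>\<^sup>2w k\<close> and \<open>\<nabla>w\<close>, so the identity reads \<open>A\<^sup>u = w \<nabla>\<^sup>2w - \<bar>\<nabla>w\<bar>\<^sup>2/2 I\<close> as quadratic forms.
\<close>

lemma conformal_hessian_quadratic_form:
  fixes u :: "real^'n \<Rightarrow> real" and p :: real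
  assumes n: "CARD('n) \<ge> 3" and p: "p = - 2 / (real CARD('n) - 2)"
  shows "k \<bullet> (conformal_hessian u x *v k) =
    u x powr p * (k \<bullet> ((p * (p - 1) * u x powr (p - 2) * (gradient u x \<bullet> k)) *\<^sub>R gradient u x
        + (p * u x powr (p - 1)) *\<^sub>R (hessian u x *v k)))
    - (norm ((p * u x powr (p - 1)) *\<^sub>R gradient u x))\<^sup>2 * (norm k)\<^sup>2 / 2"
proof -
  define n where "n = real CARD('n)"
  define m where "m = n - 2"
  have n2: "m \<noteq> 0" using assms by (simp add: n_def m_def)
  have p': "p = - 2 / m" by (simp add: p n_def m_def)
  have nm: "n = m + 2" by (simp add: m_def)
  have outer: "outer_product g g *v k = (g \<bullet> k) *\<^sub>R g" for g :: "real^'n"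
    by (simp add: vec_eq_iff matrix_vector_mult_def outer_product_def inner_vec_def
        sum_distrib_left mult_ac)
  have e1: "- ((n + 2) / (n - 2)) = p + (p - 1)" and e2: "- (2 * n / (n - 2)) = p + (p - 2)"
    and c1: "- (2 / (n - 2)) = p" and c2: "2 * n / (n - 2)\<^sup>2 = p * (p - 1)"
    and c3: "2 / (n - 2)\<^sup>2 = p\<^sup>2 / 2"
    using n2 unfolding p' nm by (simp_all add: field_simps power2_eq_square)
  have sq: "(u x powr (p - 1))\<^sup>2 = u x powr p * u x powr (p - 2)"
    by (simp add: power2_eq_square flip: powr_add)
  show ?thesis
    unfolding conformal_hessian_def Let_def n_def[symmetric] e1 e2 c1 c2 c3 powr_add
    by (simp only: matrix_vector_mult_add_rdistrib matrix_vector_mult_diff_rdistrib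
        scaleR_matrix_vector_assoc[symmetric] outer inner_add_right inner_diff_right
        power_mult_distrib inner_commute[of k "gradient u x"] inner_scaleR_right norm_scaleR
        matrix_vector_mul_lid power2_abs sq dot_square_norm)
       (simp only: ring_distribs times_divide_eq_right times_divide_eq_left mult_ac add_ac)
qed

theorem corollary1p1:
  fixes u :: "real^'n \<Rightarrow> real"
  assumes "CARD('n) \<ge> 3"
    and "C2_on (ball 0 2 - {0}) u"
    and "\<forall>x \<in> ball 0 2 - {0}. u x > 0"
    and "\<forall>x \<in> ball 0 2 - {0}. conformal_hessian u x \<in> U_n"
    and "\<forall>x \<in> ball 0 2 - {0}. F_n (conformal_hessian u x) = 1"
  shows "\<exists>v :: real^'n \<Rightarrow> real.
           (\<forall>x \<in> ball 0 1 - {0}. v x = u x) \<and>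
           (\<forall>x \<in> ball 0 1. v x > 0) \<and>
           (\<exists>L. L-lipschitz_on (ball 0 1) v)"
proof -
  define p where "p = - 2 / (real CARD('n) - 2)"
  have p: "p < 0" using assms(1) by (simp add: p_def)
  define w where "w = (\<lambda>x. u x powr p)"
  define G where "G = (\<lambda>x. (p * u x powr (p - 1)) *\<^sub>R gradient u x)"
  define S where "S = (\<lambda>x k. (p * (p - 1) * u x powr (p - 2) * (gradient u x \<bullet> k)) *\<^sub>R gradient u x
        + (p * u x powr (p - 1)) *\<^sub>R (hessian u x *v k))"
  interpret punctured_conformal_factor w G S
  proof
    show "2 \<le> DIM(real^'n)" using assms(1) by simp
  next
    fix x :: "real^'n" assume x: "x \<in> ball 0 2 - {0}"
    have u: "0 < u x" using assms(3) x by blast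
    show "0 < w x" using u by (simp add: w_def)
    have du: "(u has_derivative (\<lambda>h. gradient u x \<bullet> h)) (at x)"
      using assms(2) x by (intro has_derivative_gradient) (auto simp: C2_on_def)
    have dgrad: "(gradient u has_derivative (\<lambda>h. hessian u x *v h)) (at x)"
      using assms(2) x unfolding hessian_def by (subst jacobian_works[symmetric]) (auto simp: C2_on_def)
    have dpow: "((\<lambda>y. u y powr a) has_derivative (\<lambda>h. (a * u x powr (a - 1)) * (gradient u x \<bullet> h))) (at x)" for a
      using has_derivative_compose[OF du has_field_derivative_imp_has_derivative[OF has_real_derivative_powr[OF u, of a]]]
      by simp
    show "(w has_derivative (\<lambda>k. G x \<bullet> k)) (at x)"
      using dpow[of p] by (simp add: w_def G_def)
    show "(G has_derivative S x) (at x)"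
      unfolding G_def S_def
      by (rule has_derivative_eq_rhs[OF has_derivative_scaleR[OF has_derivative_mult_right[OF dpow] dgrad]])
         (simp add: fun_eq_iff algebra_simps)
    fix k :: "real^'n" assume "k \<noteq> 0"
    have "conformal_hessian u x \<in> U_n" using assms(4) x by blast
    from U_n_positive_definite[OF this \<open>k \<noteq> 0\<close>]
    show "(norm (G x))\<^sup>2 * (norm k)\<^sup>2 / 2 < w x * (k \<bullet> S x k)"
      unfolding conformal_hessian_quadratic_form[OF assms(1) p_def] G_def S_def w_def by simp
  qed
  obtain W L m where W: "L-lipschitz_on (cball 0 1) W" "0 < m"
    "\<And>x. x \<in> cball 0 1 \<Longrightarrow> m \<le> W x" "\<And>x. x \<in> cball 0 1 - {0} \<Longrightarrow> W x = w x"
    using positive_lipschitz_extension by metis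
  show ?thesis
  proof (intro exI conjI ballI)
    fix x :: "real^'n"
    show "W x powr (1 / p) = u x" if "x \<in> ball 0 1 - {0}"
    proof -
      have "0 < u x" using assms(3) that by auto
      then show ?thesis using W(4)[of x] that p by (simp add: w_def powr_powr)
    qed
    show "0 < W x powr (1 / p)" if "x \<in> ball 0 1"
      using W(2) W(3)[of x] that by auto
    have "1 / p \<le> 1" using p by (simp add: divide_simps)
    from powr_lipschitz_on[OF W(2) this]
    have "(\<bar>1 / p\<bar> * m powr (1 / p - 1))-lipschitz_on (W ` ball 0 1) (\<lambda>x. x powr (1 / p))"
      by (rule lipschitz_on_subset) (use W(3) in auto)
    moreover have "L-lipschitz_on (ball 0 1) W"
      by (rule lipschitz_on_subset[OF W(1)]) auto
    ultimately show "((\<bar>1 / p\<bar> * m powr (1 / p - 1)) * L)-lipschitz_on (ball 0 1) (\<lambda>x. W x powr (1 / p))"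
      using lipschitz_on_compose2 by blast
  qed
qed

end
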